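(* Let $S\subset\mathbb{F}_q^k$ be an arc, let $t=q+k-1-|S|$, let $n\ge0$, and let $G\subset S$ have size $t+k+n$. For each $A\in\binom{G}{k-2}$ fix a basis $B(A)=(b_1,b_2,A)$ of $\mathbb{F}_q^k$. Let $P_G^{\uparrow n}$ be the matrix with rows indexed by $\binom{G}{k-1}$, columns indexed by ordered pairs $(U,A)$ with $U\in\binom{G}{n}$, $A\in\binom{G\setminus U}{k-2}$, and $(C,(U,A))$-entry $f_{A,S}(C\setminus A)\prod_{y\in G\setminus(C\cup U)}\det(C\setminus A,y,A)_{B(A)}^{-1}$ if $A\subset C\subset G\setminus U$ and $0$ otherwise. Then for any basis $B$ of $\mathbb{F}_q^k$ there exist invertible diagonal matrices $D_1,D_2$ such that $D_1P_G^{\uparrow n}D_2=M_G^{\uparrow n}$, where $M_G^{\uparrow n}$ is constructed with respect to $B$.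
   Context: $\mathbb{F}_q$ is a finite field of order $q$. An arc in $\mathbb{F}_q^k$ is an ordered family of at least $k$ vectors in which every subfamily of size $k$ is a basis; subfamilies inherit the order. $\binom{X}{m}$ is the set of $m$-subsets of $X$. Tangent function: for $A\in\binom{S}{k-2}$, let $H_A^1,\dots,H_A^m$ be all the $(k-1)$-dimensional subspaces of $\mathbb{F}_q^k$ meeting $S$ exactly in $A$, $\beta_A^i$ a linear functional with kernel $H_A^i$, and $f_{A,S}(x)=\prod_i\beta_A^i(x)$ (any choice of the $\beta$'s). $f_{A,S}(C\setminus A)$ means $f_{A,S}$ evaluated at the unique vector of $C\setminus A$. $\det(x,y,A)_B$ is the determinant of the matrix with rows $x$, $y$, and the elements of $A$ in order, in coordinates w.r.t. $B$; $\det(u,C)_B$ is the determinant of the matrix with first row $u$ and remaining rows the elements of $C$ in the order inherited from $G$. $M_G^{\uparrow n}$ has the same row and column indexing as $P_G^{\uparrow n}$ and $(C,(U,A))$-entry $\prod_{u\in U}\det(u,C)_B$ if $A\subset C\subset G\setminus U$, else $0$. *)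

theory Defs
  imports
    "Jordan_Normal_Form.Determinant"
    "Jordan_Normal_Form.VS_Connect"
    "HOL-Library.Cardinality"
    "HOL-Library.Sublist"
    "HOL-Library.Ramsey"
begin

definition ordered_basis :: "nat \<Rightarrow> 'a::field vec list \<Rightarrow> bool" where
  "ordered_basis k B \<longleftrightarrow>
     distinct B \<and> vectorspace.basis class_ring (module_vec TYPE('a) k) (set B)"

text \<open>Ordered families are lists; the subfamilies of a list are its subsequences. For
  \<open>k \<ge> 2\<close> an arc has no repeated entries, so that its subfamilies correspond to the
  subsets of its underlying set, ordered by \<open>inherited_order\<close> below.\<close>

definition arc :: "nat \<Rightarrow> 'a::field vec list \<Rightarrow> bool" where
  "arc k S \<longleftrightarrow> set S \<subseteq> carrier_vec k \<and> k \<le> length S \<and>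
     (\<forall>I \<subseteq> {..<length S}. card I = k \<longrightarrow> ordered_basis k (nths S I))"

definition inherited_order :: "'b list \<Rightarrow> 'b set \<Rightarrow> 'b list" where
  "inherited_order G X = filter (\<lambda>x. x \<in> X) G"

definition coords :: "nat \<Rightarrow> 'a::field vec list \<Rightarrow> 'a vec \<Rightarrow> 'a vec" where
  "coords k B v = (THE c. c \<in> carrier_vec k \<and> mat_of_cols k B *\<^sub>v c = v)"

definition det_wrt :: "nat \<Rightarrow> 'a::field vec list \<Rightarrow> 'a vec list \<Rightarrow> 'a" where
  "det_wrt k B xs = det (mat_of_rows k (map (coords k B) xs))"

definition linear_functional :: "nat \<Rightarrow> ('a::field vec \<Rightarrow> 'a) \<Rightarrow> bool" where
  "linear_functional k \<phi> \<longleftrightarrow>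
     (\<forall>x \<in> carrier_vec k. \<forall>y \<in> carrier_vec k. \<phi> (x + y) = \<phi> x + \<phi> y) \<and>
     (\<forall>a. \<forall>x \<in> carrier_vec k. \<phi> (a \<cdot>\<^sub>v x) = a * \<phi> x)"

definition functional_kernel :: "nat \<Rightarrow> ('a::field vec \<Rightarrow> 'a) \<Rightarrow> 'a vec set" where
  "functional_kernel k \<phi> = {x \<in> carrier_vec k. \<phi> x = 0}"

definition tangent_hyperplanes ::
  "nat \<Rightarrow> 'a::field vec list \<Rightarrow> 'a vec set \<Rightarrow> 'a vec set set" where
  "tangent_hyperplanes k S A =
     {H. subspace class_ring H (module_vec TYPE('a) k) \<and>
         vectorspace.dim class_ring ((module_vec TYPE('a) k)\<lparr>carrier := H\<rparr>) = k - 1 \<and>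
         H \<inter> set S = A}"

text \<open>A choice of functionals is a function \<open>\<beta>\<close>, where \<open>\<beta> A H\<close> is the functional
  attached to the hyperplane \<open>H\<close> that meets \<open>S\<close> exactly in \<open>A\<close>.\<close>

definition tangent_choice ::
  "nat \<Rightarrow> 'a::field vec list \<Rightarrow> ('a vec set \<Rightarrow> 'a vec set \<Rightarrow> 'a vec \<Rightarrow> 'a) \<Rightarrow> bool" where
  "tangent_choice k S \<beta> \<longleftrightarrow>
     (\<forall>A \<in> nsets (set S) (k - 2). \<forall>H \<in> tangent_hyperplanes k S A.
        linear_functional k (\<beta> A H) \<and> functional_kernel k (\<beta> A H) = H)"

definition tangent_function ::
  "nat \<Rightarrow> 'a::field vec list \<Rightarrow> ('a vec set \<Rightarrow> 'a vec set \<Rightarrow> 'a vec \<Rightarrow> 'a)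
     \<Rightarrow> 'a vec set \<Rightarrow> 'a vec \<Rightarrow> 'a" where
  "tangent_function k S \<beta> A x = (\<Prod>H \<in> tangent_hyperplanes k S A. \<beta> A H x)"

definition column_index :: "nat \<Rightarrow> nat \<Rightarrow> 'b list \<Rightarrow> ('b set \<times> 'b set) set" where
  "column_index k n G =
     {(U, A). U \<in> nsets (set G) n \<and> A \<in> nsets (set G - U) (k - 2)}"

definition P_entry ::
  "nat \<Rightarrow> 'a::field vec list \<Rightarrow> ('a vec set \<Rightarrow> 'a vec set \<Rightarrow> 'a vec \<Rightarrow> 'a)
     \<Rightarrow> ('a vec set \<Rightarrow> 'a vec list) \<Rightarrow> 'a vec list
     \<Rightarrow> 'a vec set \<Rightarrow> 'a vec set \<times> 'a vec set \<Rightarrow> 'a" where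
  "P_entry k S \<beta> Bs G C = (\<lambda>(U, A).
     if A \<subseteq> C \<and> C \<subseteq> set G - U
     then tangent_function k S \<beta> A (the_elem (C - A)) *
          (\<Prod>y \<in> set G - (C \<union> U).
             inverse (det_wrt k (Bs A) (the_elem (C - A) # y # inherited_order G A)))
     else 0)"

definition M_entry ::
  "nat \<Rightarrow> 'a::field vec list \<Rightarrow> 'a vec list
     \<Rightarrow> 'a vec set \<Rightarrow> 'a vec set \<times> 'a vec set \<Rightarrow> 'a" where
  "M_entry k B G C = (\<lambda>(U, A).
     if A \<subseteq> C \<and> C \<subseteq> set G - U
     then (\<Prod>u \<in> U. det_wrt k B (u # inherited_order G C))
     else 0)"

text \<open>The matrix with rows and columns indexed by finite sets, which are enumerated
  by the lists \<open>rs\<close> and \<open>cs\<close>.\<close>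

definition indexed_mat :: "'r list \<Rightarrow> 'c list \<Rightarrow> ('r \<Rightarrow> 'c \<Rightarrow> 'a) \<Rightarrow> 'a mat" where
  "indexed_mat rs cs f = mat (length rs) (length cs) (\<lambda>(i, j). f (rs ! i) (cs ! j))"

end

theory Submission
  imports Defs "Jordan_Normal_Form.DL_Rank"
begin

text \<open>Let \<open>C = insert x A\<close>. Up to a factor depending only on \<open>A\<close>, every determinant in the
  \<open>(C, (U, A))\<close>-entry of \<open>P\<close> is a sign times \<open>det (y, C)\<close>, and the product over
  \<open>y \<in> G - (C \<union> U)\<close> of the inverses is the entry of \<open>M\<close> divided by a quantity depending only on \<open>C\<close>.
  It remains to write \<open>f A x\<close>, corrected by the \<open>(t + 1)\<close>-st power of the sign that moves \<open>x\<close> to its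
  place in \<open>C\<close>, as \<open>a A * c C\<close>. Segre's lemma of tangents says precisely that the corrected function
  on flags \<open>A \<subseteq> C\<close> multiplies to \<open>1\<close> around the triangles \<open>D \<union> {x}, D \<union> {y}, D \<union> {z}\<close>, and this
  suffices to construct \<open>a\<close> and \<open>c\<close>, adding the vectors of \<open>G\<close> one at a time.\<close>

section \<open>Linear functionals and determinants\<close>

lemma ordered_basisD:
  fixes L :: "'a::field vec list"
  assumes "ordered_basis k L"
  shows "set L \<subseteq> carrier_vec k" "length L = k" "det (mat_of_cols k L) \<noteq> 0"
proof -
  interpret vec_space "TYPE('a)" k .
  have d: "distinct L" and b: "basis (set L)"
    using assms by (auto simp: ordered_basis_def)
  show car: "set L \<subseteq> carrier_vec k" using b by (auto simp: basis_def)
  have "dim = card (set L)" using dim_basis[OF _ b] by simp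
  then show len: "length L = k" using distinct_card[OF d] dim_is_n by simp
  have cols: "cols (mat_of_cols k L) = L" using car by (simp add: cols_mat_of_cols)
  have "rank (mat_of_cols k L) = k"
    by (rule lin_indpt_full_rank) (use len d b in \<open>auto simp: cols basis_def\<close>)
  then show "det (mat_of_cols k L) \<noteq> 0"
    by (subst det_rank_iff) (auto simp: len)
qed

lemma det_mat_of_rows_eq_cols:
  assumes "set L \<subseteq> carrier_vec k" "length L = k"
  shows "det (mat_of_rows k L) = det (mat_of_cols k L)"
proof -
  have "mat_of_cols k L = (mat_of_rows k L)\<^sup>T"
    by (simp add: transpose_mat_of_rows)
  moreover have "mat_of_rows k L \<in> carrier_mat k k"
    using assms(2) by (intro carrier_matI) auto
  ultimately show ?thesis by (simp add: det_transpose)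
qed

text \<open>The scalar \<open>\<phi> v\<close> is wrapped as a vector of length 1, so that
  rank-nullity for linear maps between two vector spaces applies to functionals.\<close>

lemma linear_functional_linear_map:
  fixes \<phi> :: "'a::field vec \<Rightarrow> 'a"
  assumes "linear_functional k \<phi>"
  shows "linear_map class_ring (module_vec TYPE('a) k) (module_vec TYPE('a) 1) (\<lambda>v. vec 1 (\<lambda>_. \<phi> v))"
  using assms vec_vs[where 'a='a and n=k] vec_vs[where 'a='a and n=1]
  unfolding linear_map_def mod_hom_def mod_hom_axioms_def vectorspace_def
  by (auto simp: LinearCombinations.module_hom_def module_vec_simps class_ring_simps linear_functional_def)

text \<open>A functional that is nonzero at some \<open>v\<close> is onto, since multiples of
  \<open>v\<close> attain every scalar; rank-nullity then gives the kernel codimension 1.\<close>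

lemma functional_kernel_subspace:
  fixes \<phi> :: "'a::field vec \<Rightarrow> 'a"
  assumes "linear_functional k \<phi>"
  shows "subspace class_ring (functional_kernel k \<phi>) (module_vec TYPE('a) k)"
    and "(\<exists>v \<in> carrier_vec k. \<phi> v \<noteq> 0) \<Longrightarrow>
      vectorspace.dim class_ring ((module_vec TYPE('a) k)\<lparr>carrier := functional_kernel k \<phi>\<rparr>) = k - 1"
proof -
  let ?T = "\<lambda>v. vec 1 (\<lambda>_. \<phi> v)"
  interpret T: linear_map class_ring "module_vec TYPE('a) k" "module_vec TYPE('a) 1" ?T
    by (rule linear_functional_linear_map[OF assms])
  have ker: "T.kerT = functional_kernel k \<phi>"
    unfolding T.ker_def functional_kernel_def by (auto simp: module_vec_simps vec_eq_iff)
  show "subspace class_ring (functional_kernel k \<phi>) (module_vec TYPE('a) k)"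
    using T.kerT_is_subspace unfolding ker .
  assume "\<exists>v \<in> carrier_vec k. \<phi> v \<noteq> 0"
  then obtain v where v: "v \<in> carrier_vec k" "\<phi> v \<noteq> 0" by blast
  have "T.imT = carrier (module_vec TYPE('a) 1)"
  proof -
    have "w \<in> ?T ` carrier_vec k" if w: "w \<in> carrier_vec 1" for w
    proof
      show "w = ?T ((w $ 0 / \<phi> v) \<cdot>\<^sub>v v)"
        using assms v w by (intro eq_vecI) (auto simp: linear_functional_def)
    qed (use v in auto)
    then show ?thesis unfolding T.im_def by (auto simp: module_vec_simps)
  qed
  then have "T.W.dim + vectorspace.dim class_ring ((module_vec TYPE('a) k)\<lparr>carrier := functional_kernel k \<phi>\<rparr>)
      = T.V.dim"
    using T.rank_nullity_main(1) vec_space.fin_dim[where 'a='a and n=k] unfolding ker by simp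
  then show "vectorspace.dim class_ring ((module_vec TYPE('a) k)\<lparr>carrier := functional_kernel k \<phi>\<rparr>) = k - 1"
    using vec_space.dim_is_n[where 'a='a and n=k] vec_space.dim_is_n[where 'a='a and n=1] by simp
qed

lemma linear_functional_zero_on_basis:
  fixes \<phi> :: "'a::field vec \<Rightarrow> 'a"
  assumes "linear_functional k \<phi>" "ordered_basis k L" "\<And>v. v \<in> set L \<Longrightarrow> \<phi> v = 0"
    and "v \<in> carrier_vec k"
  shows "\<phi> v = 0"
proof -
  interpret vec_space "TYPE('a)" k .
  have "span (set L) \<subseteq> functional_kernel k \<phi>"
  proof (rule span_is_subset)
    show "set L \<subseteq> functional_kernel k \<phi>"
      using assms ordered_basisD(1)[OF assms(2)] by (auto simp: functional_kernel_def)
    show "submodule class_ring (functional_kernel k \<phi>) V"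
      using functional_kernel_subspace(1)[OF assms(1)] by (simp add: subspace_def)
  qed
  moreover have "span (set L) = carrier_vec k"
    using assms(2) by (auto simp: ordered_basis_def basis_def)
  ultimately show ?thesis using assms(4) by (auto simp: functional_kernel_def)
qed

text \<open>The columns of the inverse of the matrix with rows \<open>L\<close> form the dual basis:
  row \<open>j\<close> times column \<open>i\<close> of the inverse is an entry of the
  identity.\<close>

lemma dual_functional_exists:
  fixes L :: "'a::field vec list"
  assumes "ordered_basis k L" "x \<in> set L"
  obtains \<phi> where "linear_functional k \<phi>" "\<phi> x = 1" "\<And>v. v \<in> set L \<Longrightarrow> v \<noteq> x \<Longrightarrow> \<phi> v = 0"
proof -
  note L = ordered_basisD[OF assms(1)]
  let ?R = "mat_of_rows k L"
  have R: "?R \<in> carrier_mat k k" using L(2) by (intro carrier_matI) auto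
  have "det ?R \<noteq> 0" using L by (simp add: det_mat_of_rows_eq_cols)
  from det_non_zero_imp_unit[OF R this, unfolded Units_def ring_mat_def]
  obtain R' where R': "R' \<in> carrier_mat k k" "?R * R' = 1\<^sub>m k" by auto
  obtain i where i: "i < k" "L ! i = x" using assms(2) L(2) by (auto simp: in_set_conv_nth)
  define \<phi> where "\<phi> v = v \<bullet> col R' i" for v
  have val: "\<phi> (L ! j) = (if j = i then 1 else 0)" if "j < k" for j
  proof -
    have "row ?R j = L ! j" using L that by (intro mat_of_rows_row) auto
    then have "\<phi> (L ! j) = (?R * R') $$ (j, i)" 
      using R' i that L(2) by (subst index_mult_mat(1)) (auto simp: \<phi>_def)
    then show ?thesis using R' i that by simp
  qed
  show thesis
  proof
    show "linear_functional k \<phi>"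
      using R' by (auto simp: linear_functional_def \<phi>_def add_scalar_prod_distrib[of _ k])
    show "\<phi> x = 1" using val i by auto
    show "\<phi> v = 0" if "v \<in> set L" "v \<noteq> x" for v
      using that val i L(2) by (auto simp: in_set_conv_nth)
  qed
qed

text \<open>The coordinate matrix times the transposed basis matrix is the matrix of the vectors
  themselves. A change of basis therefore costs only a constant factor.\<close>

lemma det_wrt_eq:
  fixes B :: "'a::field vec list"
  assumes "ordered_basis k B" "set xs \<subseteq> carrier_vec k" "length xs = k"
  shows "det_wrt k B xs = det (mat_of_rows k xs) / det (mat_of_cols k B)"
proof -
  note B = ordered_basisD[OF assms(1)]
  let ?M = "mat_of_cols k B"
  have M: "?M \<in> carrier_mat k k" using B(2) by auto
  from det_non_zero_imp_unit[OF M B(3), unfolded Units_def ring_mat_def]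
  obtain M' where M': "M' \<in> carrier_mat k k" "?M * M' = 1\<^sub>m k" "M' * ?M = 1\<^sub>m k" by auto
  have coords: "coords k B v \<in> carrier_vec k \<and> ?M *\<^sub>v coords k B v = v" if v: "v \<in> carrier_vec k" for v
    unfolding coords_def
  \<comment> \<open>Invertibility of \<open>?M\<close> gives existence and uniqueness, so the
    definite description in \<open>coords\<close> is meaningful.\<close>
  proof (rule theI[of _ "M' *\<^sub>v v"])
    show "M' *\<^sub>v v \<in> carrier_vec k \<and> ?M *\<^sub>v (M' *\<^sub>v v) = v"
      using M M' v by (auto simp: assoc_mult_mat_vec[symmetric])
    show "c = M' *\<^sub>v v" if "c \<in> carrier_vec k \<and> ?M *\<^sub>v c = v" for c
      using M M' that by (auto simp: assoc_mult_mat_vec[symmetric])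
  qed
  let ?C = "mat_of_rows k (map (coords k B) xs)"
  have C: "?C \<in> carrier_mat k k" using assms(3) by auto
  have "?C * ?M\<^sup>T = mat_of_rows k xs"
  proof (rule eq_matI)
    fix i j assume "i < dim_row (mat_of_rows k xs)" "j < dim_col (mat_of_rows k xs)"
    then have ij: "i < k" "j < k" using assms(3) by auto
    then have xi: "xs ! i \<in> carrier_vec k" using assms by auto
    have "row ?C i = coords k B (xs ! i)"
      using ij assms(3) coords[OF xi] by (subst mat_of_rows_row) auto
    then have "(?C * ?M\<^sup>T) $$ (i, j) = coords k B (xs ! i) \<bullet> row ?M j"
      using ij M C assms(3) by simp
    also have "\<dots> = (?M *\<^sub>v coords k B (xs ! i)) $ j"
      
      using ij M coords[OF xi] by (subst index_mult_mat_vec) (auto intro: comm_scalar_prod)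
    finally show "(?C * ?M\<^sup>T) $$ (i, j) = mat_of_rows k xs $$ (i, j)"
      using coords[OF xi] ij assms(3) by (simp add: mat_of_rows_index)
  qed (use assms(3) B(2) in auto)
  then have "det (mat_of_rows k xs) = det ?C * det ?M"
    using C M by (metis det_mult det_transpose transpose_carrier_mat)
  then show ?thesis using B(3) by (simp add: det_wrt_def)
qed

lemma det_move_to_front:
  assumes "set (us @ x # vs) \<subseteq> carrier_vec k" "length (us @ x # vs) = k"
  shows "det (mat_of_rows k (us @ x # vs)) = (- 1) ^ length us * det (mat_of_rows k (x # us @ vs))"
proof -
  let ?A = "mat_of_rows k (us @ x # vs)"
  have A: "?A \<in> carrier_mat k k" using assms(2) by (intro carrier_matI) auto
  \<comment> \<open>This is the exchange of the initial block \<open>us\<close> with the single row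
    \<open>x\<close> that follows it, in the shape produced by
    \<open>det_swap_initial_rows\<close>.\<close>
  have "mat k k (\<lambda>(i, j). ?A $$ (if i < 1 then i + length us
          else if i < length us + 1 then i - 1 else i, j)) = mat_of_rows k (x # us @ vs)"
    using assms(2)
    by (intro eq_matI) (auto simp: mat_of_rows_index nth_append nth_Cons' less_Suc_eq_le split: if_splits)
  then show ?thesis
    using det_swap_initial_rows[OF A, of "length us" 1] assms(2) by simp
qed

section \<open>Segre's lemma of tangents\<close>

text \<open>Each element cancels against its inverse, which is a different element because no square
  in question is 1; the induction removes one such pair at a time.\<close>

lemma prod_eq_1_if_inverse_closed:
  fixes X :: "'a::field set"
  assumes "finite X" "\<And>a. a \<in> X \<Longrightarrow> a \<noteq> 0 \<and> a * a \<noteq> 1 \<and> inverse a \<in> X"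
  shows "\<Prod>X = 1"
  using assms
proof (induction X rule: finite_psubset_induct)
  case (psubset X)
  show ?case
  proof (cases "X = {}")
    case False
    then obtain a where a: "a \<in> X" by blast
    note a' = psubset.prems[OF a]
    have ne: "inverse a \<noteq> a" using a' by (metis right_inverse)
    have "\<Prod>(X - {a, inverse a}) = 1"
    proof (rule psubset.IH)
      fix b assume b: "b \<in> X - {a, inverse a}"
      have "inverse b \<noteq> a" "inverse b \<noteq> inverse a" using b by auto
      then show "b \<noteq> 0 \<and> b * b \<noteq> 1 \<and> inverse b \<in> X - {a, inverse a}"
        using b psubset.prems[of b] by blast
    qed (use a in blast)
    moreover have "\<Prod>X = \<Prod>(X - {a, inverse a}) * \<Prod>{a, inverse a}"
      using a a' psubset.hyps by (intro prod.subset_diff) auto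
    ultimately show ?thesis using a' ne by simp
  qed simp
qed

lemma prod_nonzero_elements_finite_field:
  "\<Prod>(UNIV - {0 :: 'a::{field,finite}}) = -1"
proof -
  let ?X = "{a :: 'a. a \<noteq> 0 \<and> a * a \<noteq> 1}"
  have "\<Prod>?X = 1"
    by (rule prod_eq_1_if_inverse_closed)
      (auto simp flip: inverse_mult_distrib simp: inverse_eq_1_iff)
  moreover have "UNIV - {0} = ?X \<union> {1, -1 :: 'a}"
    by (auto simp: square_eq_1_iff)
  then have "\<Prod>(UNIV - {0 :: 'a}) = \<Prod>?X * \<Prod>{1, -1 :: 'a}"
    by (simp only:) (rule prod.union_disjoint, auto)
  moreover have "\<Prod>{1, -1 :: 'a} = -1"
  \<comment> \<open>In characteristic 2 the two self-inverse elements coincide, and the single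
    factor 1 is again -1.\<close>
  proof (cases "(1 :: 'a) = -1")
    case True
    then have "{1, -1 :: 'a} = {-1}" by simp
    then show ?thesis by (simp only:) simp
  qed simp
  ultimately show ?thesis by simp
qed

section \<open>Bases and dual functionals from subsets of an arc\<close>

text \<open>Since \<open>2 \<le> k\<close>, two positions with equal entries lie in a common index
  set of size \<open>k\<close>, whose subfamily would be a basis listed with a repetition.\<close>

lemma arc_distinct:
  assumes "2 \<le> k" "arc k S"
  shows "distinct S"
proof (rule ccontr)
  assume "\<not> distinct S"
  then obtain i j where ij: "i < length S" "j < length S" "i \<noteq> j" "S ! i = S ! j"
    by (auto simp: distinct_conv_nth)
  have "k \<le> length S" using assms(2) by (simp add: arc_def)
  then obtain I where I: "{i, j} \<subseteq> I" "I \<subseteq> {..<length S}" "card I = k"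
    using exists_subset_between[of "{i, j}" k "{..<length S}"] ij assms(1) by auto
  then have basis: "ordered_basis k (nths S I)" using assms(2) by (simp add: arc_def)
  have "{p. p < length S \<and> p \<in> I} = I" using I(2) by auto
  then have "length (nths S I) = k" using I(3) by (simp add: length_nths)
  then have "card (set (nths S I)) = card I"
    using basis I(3) distinct_card by (force simp: ordered_basis_def)
  moreover have "set (nths S I) = (!) S ` I" using I(2) by (auto simp: set_nths)
  ultimately have "inj_on ((!) S) I"
    using I(2) finite_subset by (metis eq_card_imp_inj_on finite_lessThan)
  then show False using I(1) ij by (auto dest: inj_onD)
qed

text \<open>Passes from index sets, in which arcs are defined, to subsets of the underlying set;
  being a basis does not depend on the order of listing.\<close>

lemma arc_ordered_basis:
  assumes "2 \<le> k" "arc k S" "T \<subseteq> set S" "card T = k" "set L = T" "distinct L"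
  shows "ordered_basis k L"
proof -
  have d: "distinct S" by (rule arc_distinct[OF assms(1,2)])
  define I where "I = {i. i < length S \<and> S ! i \<in> T}"
  have im: "(!) S ` I = T"
    using assms(3) by (auto simp: I_def in_set_conv_nth image_iff) (metis in_set_conv_nth subsetD)
  have "inj_on ((!) S) I" using d by (auto simp: I_def inj_on_def nth_eq_iff_index_eq)
  then have "card I = k" using card_image im assms(4) by metis
  moreover have "I \<subseteq> {..<length S}" by (auto simp: I_def)
  ultimately have "ordered_basis k (nths S I)" using assms(2) by (simp add: arc_def)
  moreover have "set (nths S I) = T" using im by (auto simp: set_nths I_def)
  ultimately show ?thesis using assms(5,6) by (simp add: ordered_basis_def)
qed

lemma arc_functional_zero:
  assumes "2 \<le> k" "arc k S" "T \<subseteq> set S" "card T = k"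
    and "linear_functional k \<phi>" "\<And>v. v \<in> T \<Longrightarrow> \<phi> v = 0" "v \<in> carrier_vec k"
  shows "\<phi> v = 0"
proof -
  obtain L where L: "set L = T" "distinct L"
    using finite_distinct_list[of T] finite_subset[OF assms(3)] by auto
  show ?thesis
    using linear_functional_zero_on_basis[OF assms(5) arc_ordered_basis[OF assms(1-4) L]] L assms(6,7)
    by auto
qed

lemma arc_dual_functional:
  assumes "2 \<le> k" "arc k S" "T \<subseteq> set S" "card T = k" "x \<in> T"
  obtains \<phi> where "linear_functional k \<phi>" "\<phi> x = 1" "\<And>v. v \<in> T \<Longrightarrow> v \<noteq> x \<Longrightarrow> \<phi> v = 0"
proof -
  obtain L where L: "set L = T" "distinct L"
    using finite_distinct_list[of T] finite_subset[OF assms(3)] by auto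
  show thesis
    using dual_functional_exists[OF arc_ordered_basis[OF assms(1-4) L], of x] L assms(5) that by auto
qed

text \<open>If \<open>\<phi> s\<close> were 0, then \<open>\<phi>\<close> would vanish on the
  \<open>k\<close>-subset obtained from \<open>T\<close> by exchanging \<open>x\<close> for
  \<open>s\<close>, hence everywhere, against \<open>\<phi> x = 1\<close>.\<close>

lemma arc_dual_functional_nonzero:
  assumes "2 \<le> k" "arc k S" "T \<subseteq> set S" "card T = k" "x \<in> T"
    and "linear_functional k \<phi>" "\<phi> x = 1" "\<And>v. v \<in> T \<Longrightarrow> v \<noteq> x \<Longrightarrow> \<phi> v = 0"
    and "s \<in> set S - T"
  shows "\<phi> s \<noteq> 0"
proof
  assume "\<phi> s = 0"
  have "finite T" using assms(3) by (rule finite_subset) simp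
  then have card: "card (insert s (T - {x})) = k"
    using assms(1,4,5,9) by (simp add: card_Diff_singleton)
  have "\<phi> x = 0"
    by (rule arc_functional_zero[OF assms(1,2) _ card assms(6)])
      (use assms \<open>\<phi> s = 0\<close> in \<open>auto simp: arc_def\<close>)
  then show False using assms(7) by simp
qed

lemma linear_functional_combination:
  assumes "linear_functional k \<phi>" "linear_functional k \<psi>"
  shows "linear_functional k (\<lambda>v. a * \<phi> v + b * \<psi> v)"
  using assms by (auto simp: linear_functional_def algebra_simps)

section \<open>Tangent functions\<close>

lemma tangent_functional_nonzero:
  assumes "tangent_choice k S \<beta>" "set S \<subseteq> carrier_vec k"
    and "A \<in> nsets (set S) (k - 2)" "H \<in> tangent_hyperplanes k S A" "y \<in> set S - A"
  shows "\<beta> A H y \<noteq> 0"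
proof
  assume "\<beta> A H y = 0"
  then have "y \<in> functional_kernel k (\<beta> A H)" using assms(2,5) by (auto simp: functional_kernel_def)
  then have "y \<in> H \<inter> set S" using assms by (auto simp: tangent_choice_def)
  then show False using assms(4,5) by (auto simp: tangent_hyperplanes_def)
qed

lemma tangent_function_nonzero:
  fixes S :: "'a::field vec list"
  assumes "tangent_choice k S \<beta>" "set S \<subseteq> carrier_vec k"
    and "A \<in> nsets (set S) (k - 2)" "y \<in> set S - A"
  shows "tangent_function k S \<beta> A y \<noteq> 0"
  unfolding tangent_function_def
  \<comment> \<open>The field need not be finite here; a product over an infinite set is 1 by
    convention.\<close>
  by (cases "finite (tangent_hyperplanes k S A)")
    (use tangent_functional_nonzero[OF assms(1-3) _ assms(4)] in auto)

text \<open>The hyperplanes through \<open>insert x D\<close> that avoid \<open>y\<close> and \<open>z\<close> are the loci \<open>Z = c Y\<close> with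
  \<open>c \<noteq> 0\<close>. Each one is either tangent or spanned by \<open>insert x D\<close> and a unique further point \<open>s\<close>
  of the arc, so the product of the slopes \<open>c\<close> over all of them, which is \<open>-1\<close> by Wilson's theorem,
  splits into a product over the tangents and one over the arc.\<close>

lemma tangent_function_ratio:
  fixes S :: "'a::{field,finite} vec list"
  assumes k: "3 \<le> k" and arc: "arc k S" and tc: "tangent_choice k S \<beta>"
    and D: "D \<in> nsets (set S) (k - 3)"
    and xyz: "x \<in> set S - D" "y \<in> set S - D" "z \<in> set S - D" "x \<noteq> y" "x \<noteq> z" "y \<noteq> z"
    and T: "T = D \<union> {x, y, z}" and R: "R = set S - T"
    and Y: "linear_functional k Y" "Y y = 1" "\<And>v. v \<in> T \<Longrightarrow> v \<noteq> y \<Longrightarrow> Y v = 0"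
    and Z: "linear_functional k Z" "Z z = 1" "\<And>v. v \<in> T \<Longrightarrow> v \<noteq> z \<Longrightarrow> Z v = 0"
  shows "tangent_function k S \<beta> (insert x D) y * prod Z R =
      (- 1) ^ (CARD('a) - card R) * tangent_function k S \<beta> (insert x D) z * prod Y R"
proof -
  define A where "A = insert x D"
  \<comment> \<open>The hyperplane through \<open>A\<close> and \<open>s\<close> is the locus
    \<open>Z = \<rho> s * Y\<close>; a tangent \<open>H\<close> is the locus
    \<open>Z = slope H * Y\<close>.\<close>
  define \<rho> where "\<rho> s = Z s / Y s" for s
  define slope where "slope H = - \<beta> A H y / \<beta> A H z" for H
  let ?Th = "tangent_hyperplanes k S A"
  have k2: "2 \<le> k" using k by simp
  have car: "set S \<subseteq> carrier_vec k" using arc by (simp add: arc_def)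
  have Dfin: "finite D" "card D = k - 3" "D \<subseteq> set S" using D by (auto simp: nsets_def)
  have A: "A \<in> nsets (set S) (k - 2)"
    using Dfin xyz(1) k by (auto simp: A_def nsets_def)
  have card_add: "card (insert u (insert v (insert w D))) = k"
    if "u \<notin> D" "v \<notin> D" "w \<notin> D" "u \<noteq> v" "u \<noteq> w" "v \<noteq> w" for u v w
    using Dfin k that by simp
  note zeroI = arc_functional_zero[OF k2 arc]
  have TS: "T \<subseteq> set S" "card T = k"
    using Dfin xyz k by (auto simp: T)
  have Ys: "Y s \<noteq> 0" and Zs: "Z s \<noteq> 0" if "s \<in> R" for s
    using arc_dual_functional_nonzero[OF k2 arc TS _ Y] arc_dual_functional_nonzero[OF k2 arc TS _ Z]
      that by (auto simp: R T)
  have Y0: "Y v = 0" and Z0: "Z v = 0" if "v \<in> A" for v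
    using that Y(3)[of v] Z(3)[of v] xyz by (auto simp: A_def T)
  have Yz: "Y z = 0" and Zy: "Z y = 0" using Y(3)[of z] Z(3)[of y] xyz by (auto simp: T)
  have yzA: "y \<in> set S - A" "z \<in> set S - A" using xyz by (auto simp: A_def)
  have linZY: "linear_functional k (\<lambda>v. Z v - c * Y v)" for c
    using linear_functional_combination[OF Z(1) Y(1), of 1 "-c"] by simp
  \<comment> \<open>Two points of equal slope would form with \<open>A\<close> a
    \<open>k\<close>-subset of the arc on which \<open>Z - \<rho> s * Y\<close> vanishes, yet this
    functional is 1 at \<open>z\<close>.\<close>
  have inj_\<rho>: "inj_on \<rho> R"
  proof (rule inj_onI, rule ccontr)
    fix s s' assume s: "s \<in> R" "s' \<in> R" "\<rho> s = \<rho> s'" "s \<noteq> s'"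
    have "Z z - \<rho> s * Y z = 0"
    proof (rule zeroI[OF _ _ linZY])
      show "card (insert s (insert s' (insert x D))) = k"
        using s xyz by (intro card_add) (auto simp: R T)
      show "Z v - \<rho> s * Y v = 0" if "v \<in> insert s (insert s' (insert x D))" for v
      proof -
        have "Z s - \<rho> s * Y s = 0" using Ys[OF s(1)] by (simp add: \<rho>_def)
        moreover have "Z s' - \<rho> s * Y s' = 0" unfolding s(3) using Ys[OF s(2)] by (simp add: \<rho>_def)
        ultimately show ?thesis using that Y0 Z0 by (auto simp: A_def)
      qed
    qed (use s xyz car Dfin in \<open>auto simp: R T\<close>)
    then show False using Z(2) Yz by simp
  qed
  have \<beta>: "linear_functional k (\<beta> A H)" "functional_kernel k (\<beta> A H) = H"
    "H \<inter> set S = A" if "H \<in> ?Th" for H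
    using that tc A by (auto simp: tangent_choice_def tangent_hyperplanes_def)
  have \<beta>nz: "\<beta> A H y \<noteq> 0" "\<beta> A H z \<noteq> 0" if "H \<in> ?Th" for H
    using tangent_functional_nonzero[OF tc car A that] yzA by auto
  have mem: "v \<in> H \<longleftrightarrow> v \<in> carrier_vec k \<and> Z v = slope H * Y v" if H: "H \<in> ?Th" for H v
  proof (cases "v \<in> carrier_vec k")
    case True
    have AH: "\<beta> A H u = 0" if "u \<in> A" for u
      using \<beta>[OF H] that by (auto simp: functional_kernel_def)
    \<comment> \<open>As \<open>\<beta> A H\<close> vanishes on \<open>A\<close>, its expansion in
      the dual basis of \<open>T\<close> has only the terms in \<open>Y\<close> and
      \<open>Z\<close>.\<close>
    have "1 * \<beta> A H v + (- 1) * (\<beta> A H y * Y v + \<beta> A H z * Z v) = 0"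
    proof (rule zeroI[OF _ _ linear_functional_combination[OF \<beta>(1)[OF H] linear_functional_combination[OF Y(1) Z(1)]]])
      show "card (insert y (insert z (insert x D))) = k"
        using xyz by (intro card_add) auto
      show "1 * \<beta> A H u + (- 1) * (\<beta> A H y * Y u + \<beta> A H z * Z u) = 0"
        if "u \<in> insert y (insert z (insert x D))" for u
        using that Y(2) Z(2) Yz Zy AH[of u] Y0[of u] Z0[of u] unfolding A_def by auto
    qed (use xyz Dfin True in auto)
    then have "\<beta> A H v = \<beta> A H y * Y v + \<beta> A H z * Z v" by (simp add: algebra_simps)
    moreover have "v \<in> H \<longleftrightarrow> \<beta> A H v = 0"
      using \<beta>(2)[OF H] True by (auto simp: functional_kernel_def)
    ultimately show ?thesis using True \<beta>nz[OF H] by (auto simp: slope_def field_simps eq_neg_iff_add_eq_0)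
  next
    case False
    then show ?thesis using \<beta>(2)[OF H] by (auto simp: functional_kernel_def)
  qed
  have bij: "bij_betw slope ?Th (UNIV - {0} - \<rho> ` R)"
    unfolding bij_betw_def
  proof
    show "inj_on slope ?Th"
      by (rule inj_onI) (auto simp: mem)
    show "slope ` ?Th = UNIV - {0} - \<rho> ` R"
    proof (intro equalityI subsetI)
      fix c assume "c \<in> slope ` ?Th"
      then obtain H where H: "H \<in> ?Th" "c = slope H" by blast
      have False if s: "s \<in> R" "slope H = \<rho> s" for s
      proof -
        have "s \<in> H" using s Ys[OF s(1)] car mem[OF H(1)] by (auto simp: \<rho>_def R T)
        then show False using \<beta>(3)[OF H(1)] s(1) by (auto simp: R T A_def)
      qed
      then show "c \<in> UNIV - {0} - \<rho> ` R" using \<beta>nz[OF H(1)] H(2) by (auto simp: slope_def)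
    next
      fix c assume c: "c \<in> UNIV - {0} - \<rho> ` R"
      define H where "H = functional_kernel k (\<lambda>v. Z v - c * Y v)"
      have H_mem: "v \<in> H \<longleftrightarrow> v \<in> carrier_vec k \<and> Z v = c * Y v" for v
        by (auto simp: H_def functional_kernel_def)
      have "z \<in> carrier_vec k \<and> Z z - c * Y z \<noteq> 0" using xyz car Z(2) Yz by auto
      then have sub: "subspace class_ring H (module_vec TYPE('a) k)"
        "vectorspace.dim class_ring ((module_vec TYPE('a) k)\<lparr>carrier := H\<rparr>) = k - 1"
        unfolding H_def using functional_kernel_subspace[OF linZY] by blast+
      have "v \<in> A" if v: "v \<in> H" "v \<in> set S" for v
      proof (rule ccontr)
        assume "v \<notin> A"
        then consider "v = y" | "v = z" | "v \<in> R" using v by (auto simp: A_def R T)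
        then show False
        proof cases
          case 3
          then have "c = \<rho> v" using that Ys by (simp add: H_mem \<rho>_def)
          then show False using c 3 by blast
        qed (use that c Y(2) Z(2) Yz Zy in \<open>auto simp: H_mem\<close>)
      qed
      moreover have "v \<in> H" if "v \<in> A" for v
        using that Y0 Z0 A car by (auto simp: H_mem nsets_def)
      ultimately have "H \<inter> set S = A" using A by (auto simp: nsets_def)
      then have H: "H \<in> ?Th" using sub by (simp add: tangent_hyperplanes_def)
      have yz: "y \<in> carrier_vec k" "z \<in> carrier_vec k" using xyz car by auto
      \<comment> \<open>At this vector \<open>Y\<close> is 1 and \<open>Z\<close> is
        \<open>c\<close>, so its membership in \<open>H\<close> reads off the slope.\<close>
      then have "y + c \<cdot>\<^sub>v z \<in> H"
        using Y Z Yz Zy by (auto simp: H_mem linear_functional_def)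
      then have "Z (y + c \<cdot>\<^sub>v z) = slope H * Y (y + c \<cdot>\<^sub>v z)" using mem[OF H] by blast
      then have "c = slope H"
        using Y Z Yz Zy yz by (auto simp: linear_functional_def)
      then show "c \<in> slope ` ?Th" using H by blast
    qed
  qed
  have sub: "\<rho> ` R \<subseteq> UNIV - {0}" using Ys Zs by (auto simp: \<rho>_def)
  have "card ?Th = card (UNIV - {0 :: 'a} - \<rho> ` R)" using bij by (rule bij_betw_same_card)
  also have "\<dots> = CARD('a) - 1 - card R"
    using sub inj_\<rho> by (simp add: card_Diff_subset card_image)
  finally have "card ?Th = CARD('a) - 1 - card R" .
  moreover have "card R \<le> CARD('a) - 1"
    using card_mono[OF _ sub] inj_\<rho> by (simp add: card_image)
  \<comment> \<open>The exponent in the statement exceeds the number of tangents by one; the extra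
    sign is the -1 of Wilson's theorem.\<close>
  ultimately have e: "CARD('a) - card R = Suc (card ?Th)"
    using one_le_card_finite[where 'a='a] by linarith
  have "- 1 = prod (\<lambda>c. c) (UNIV - {0 :: 'a} - \<rho> ` R) * prod (\<lambda>c. c) (\<rho> ` R)"
    using prod.subset_diff[OF sub, of "\<lambda>c. c"] by (simp add: prod_nonzero_elements_finite_field)
  also have "prod (\<lambda>c. c) (UNIV - {0 :: 'a} - \<rho> ` R) = prod slope ?Th"
    using prod.reindex_bij_betw[OF bij, of "\<lambda>c. c"] by simp
  also have "\<dots> = (- 1) ^ card ?Th * (tangent_function k S \<beta> A y / tangent_function k S \<beta> A z)"
    by (simp add: slope_def tangent_function_def prod_dividef prod_uminus)
  also have "prod (\<lambda>c. c) (\<rho> ` R) = prod Z R / prod Y R"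
    using prod.reindex[OF inj_\<rho>, of "\<lambda>c. c"] by (simp add: \<rho>_def prod_dividef)
  finally have main: "- 1 = (- 1) ^ card ?Th * (tangent_function k S \<beta> A y / tangent_function k S \<beta> A z)
      * (prod Z R / prod Y R)" .
  have "prod Y R \<noteq> 0" using Ys by (auto simp: R)
  moreover have "tangent_function k S \<beta> A z \<noteq> 0"
    using tangent_function_nonzero[OF tc car A yzA(2)] .
  ultimately have "- (tangent_function k S \<beta> A z * prod Y R) =
      (- 1) ^ card ?Th * (tangent_function k S \<beta> A y * prod Z R)"
    using main by (simp add: field_simps)
  then have "(- 1) ^ card ?Th * (- (tangent_function k S \<beta> A z * prod Y R)) =
      tangent_function k S \<beta> A y * prod Z R"
    by (simp flip: mult.assoc power_mult_distrib)
  then show ?thesis by (simp add: e A_def mult.assoc)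
qed

text \<open>Multiplying the ratio identities for the pairs at \<open>x\<close>, \<open>y\<close> and
  \<open>z\<close> makes the products of the dual functionals over the rest of the arc cancel. The
  sign occurs three times, which equals once.\<close>

lemma lemma_of_tangents:
  fixes S :: "'a::{field,finite} vec list"
  assumes k: "3 \<le> k" and arc: "arc k S" and tc: "tangent_choice k S \<beta>"
    and D: "D \<in> nsets (set S) (k - 3)"
    and xyz: "x \<in> set S - D" "y \<in> set S - D" "z \<in> set S - D" "x \<noteq> y" "x \<noteq> z" "y \<noteq> z"
  defines "f \<equiv> tangent_function k S \<beta>"
  shows "f (insert x D) y * f (insert y D) z * f (insert z D) x =
     (- 1) ^ (CARD('a) + k - length S) * (f (insert x D) z * f (insert y D) x * f (insert z D) y)"
proof -
  have k2: "2 \<le> k" using k by simp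
  have Dfin: "finite D" "card D = k - 3" "D \<subseteq> set S" using D by (auto simp: nsets_def)
  define T where "T = D \<union> {x, y, z}"
  define R where "R = set S - T"
  have T: "T \<subseteq> set S" "card T = k"
    using Dfin xyz k by (auto simp: T_def)
  have "card R = length S - k" using T distinct_card[OF arc_distinct[OF k2 arc]]
    unfolding R_def by (subst card_Diff_subset) (auto intro: finite_subset)
  moreover have "k \<le> length S" using arc by (simp add: arc_def)
  ultimately have e: "CARD('a) - card R = CARD('a) + k - length S" by linarith
  note dual = arc_dual_functional[OF k2 arc T]
  obtain X where X: "linear_functional k X" "X x = 1" "\<And>v. v \<in> T \<Longrightarrow> v \<noteq> x \<Longrightarrow> X v = 0"
    using dual[of x] by (auto simp: T_def)
  obtain Y where Y: "linear_functional k Y" "Y y = 1" "\<And>v. v \<in> T \<Longrightarrow> v \<noteq> y \<Longrightarrow> Y v = 0"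
    using dual[of y] by (auto simp: T_def)
  obtain Z where Z: "linear_functional k Z" "Z z = 1" "\<And>v. v \<in> T \<Longrightarrow> v \<noteq> z \<Longrightarrow> Z v = 0"
    using dual[of z] by (auto simp: T_def)
  note nz = arc_dual_functional_nonzero[OF k2 arc T]
  have nz3: "prod X R * prod Y R * prod Z R \<noteq> 0"
    using nz[OF _ X] nz[OF _ Y] nz[OF _ Z] by (auto simp: R_def T_def)
  define \<epsilon> :: 'a where "\<epsilon> = (- 1) ^ (CARD('a) + k - length S)"
  have \<epsilon>: "\<epsilon> * \<epsilon> = 1" by (simp add: \<epsilon>_def flip: power_mult_distrib)
  note ratio = tangent_function_ratio[OF k arc tc D _ _ _ _ _ _ _ R_def, unfolded e, folded \<epsilon>_def f_def]
  have 1: "f (insert x D) y * prod Z R = \<epsilon> * f (insert x D) z * prod Y R"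
    by (rule ratio) (use xyz Y Z in \<open>auto simp: T_def\<close>)
  have 2: "f (insert y D) z * prod X R = \<epsilon> * f (insert y D) x * prod Z R"
    by (rule ratio) (use xyz X Z in \<open>auto simp: T_def\<close>)
  have 3: "f (insert z D) x * prod Y R = \<epsilon> * f (insert z D) y * prod X R"
    by (rule ratio) (use xyz X Y in \<open>auto simp: T_def\<close>)
  have "f (insert x D) y * f (insert y D) z * f (insert z D) x * (prod X R * prod Y R * prod Z R)
      = (f (insert x D) y * prod Z R) * (f (insert y D) z * prod X R) * (f (insert z D) x * prod Y R)"
    by (simp add: mult_ac)
  also have "\<dots> = \<epsilon> * \<epsilon> * \<epsilon> * (f (insert x D) z * f (insert y D) x * f (insert z D) y)
      * (prod X R * prod Y R * prod Z R)"
    unfolding 1 2 3 by (simp add: mult_ac)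
  finally show ?thesis using nz3 by (simp add: \<epsilon> \<epsilon>_def[symmetric])
qed

section \<open>Factorization of functions on flags\<close>

text \<open>\<open>F\<close> weights the edges of the bipartite inclusion graph between
  \<open>m\<close>-sets and sets one larger. The hypothesis says that alternating products around
  the hexagons over a common \<open>D\<close> are 1, which makes \<open>F\<close> split into vertex
  weights.\<close>

lemma flag_function_factorization:
  fixes F :: "'b set \<Rightarrow> 'b set \<Rightarrow> 'a::field"
  assumes "finite V"
    and "\<And>A x. A \<subseteq> V \<Longrightarrow> card A = m \<Longrightarrow> x \<in> V - A \<Longrightarrow> F A (insert x A) \<noteq> 0"
    and "\<And>D x y z. D \<subseteq> V \<Longrightarrow> Suc (card D) = m \<Longrightarrow> {x, y, z} \<subseteq> V - D \<Longrightarrow>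
      x \<noteq> y \<Longrightarrow> x \<noteq> z \<Longrightarrow> y \<noteq> z \<Longrightarrow>
      F (insert x D) (insert x (insert y D)) * F (insert y D) (insert y (insert z D)) *
        F (insert z D) (insert z (insert x D)) =
      F (insert x D) (insert z (insert x D)) * F (insert y D) (insert x (insert y D)) *
        F (insert z D) (insert y (insert z D))"
  shows "\<exists>a c. (\<forall>A. a A \<noteq> 0) \<and> (\<forall>C. c C \<noteq> 0) \<and>
    (\<forall>A x. A \<subseteq> V \<longrightarrow> card A = m \<longrightarrow> x \<in> V - A \<longrightarrow> F A (insert x A) = a A * c (insert x A))"
  using assms
proof (induction V rule: finite_induct)
  case empty
  show ?case by (intro exI[of _ "\<lambda>_. 1"]) simp
next
  case (insert v V)
  note nz = insert.prems(1) and tri = insert.prems(2)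
  have "\<exists>a c. (\<forall>A. a A \<noteq> 0) \<and> (\<forall>C. c C \<noteq> 0) \<and>
    (\<forall>A x. A \<subseteq> V \<longrightarrow> card A = m \<longrightarrow> x \<in> V - A \<longrightarrow> F A (insert x A) = a A * c (insert x A))"
  proof (rule insert.IH)
    show "F A (insert x A) \<noteq> 0" if "A \<subseteq> V" "card A = m" "x \<in> V - A" for A x
      by (rule nz) (use that insert.hyps(2) in auto)
  qed (rule tri, auto)
  then obtain a c where a: "\<And>A. a A \<noteq> 0" and c: "\<And>C. c C \<noteq> 0"
    and ac: "\<And>A x. A \<subseteq> V \<Longrightarrow> card A = m \<Longrightarrow> x \<in> V - A \<Longrightarrow> F A (insert x A) = a A * c (insert x A)"
    by metis
  txt \<open>The values on the flags \<open>(A, insert v A)\<close> with \<open>v \<notin> A\<close> force \<open>c (insert v A)\<close>, and then any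
    flag \<open>(insert v A, insert x (insert v A))\<close> determines \<open>a (insert v A)\<close>; the triangle identity
    says that the choice of \<open>x\<close> does not matter.\<close>
  define d where "d A = F A (insert v A) / a A" for A
  \<comment> \<open>If \<open>v \<in> A\<close>, any flag above \<open>A\<close> adds an element of
    \<open>V - A\<close>, so the choice is sound wherever it is needed; otherwise it is
    arbitrary.\<close>
  define e where "e A = (SOME x. x \<in> V - A)" for A
  define a' where "a' A = (if v \<in> A then F A (insert (e A) A) / d (insert (e A) (A - {v})) else a A)" for A
  define c' where "c' C = (if v \<in> C then d (C - {v}) else c C)" for C
  have vV: "v \<notin> V" by fact
  have fact: "F A (insert x A) = a' A * c' (insert x A)"
    if A: "A \<subseteq> insert v V" "card A = m" and x: "x \<in> insert v V - A" for A x
  proof -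
    consider "v \<notin> A" "x \<noteq> v" | "v \<notin> A" "x = v" | "v \<in> A" by blast
    then show ?thesis
    proof cases
      case 1
      then show ?thesis using ac[of A x] A x by (auto simp: a'_def c'_def)
    next
      case 2
      then show ?thesis using a[of A] by (simp add: a'_def c'_def d_def)
    next
      case 3
      define D where "D = A - {v}"
      have D: "A = insert v D" "v \<notin> D" "D \<subseteq> V" using 3 A by (auto simp: D_def)
      have finD: "finite D" using D(3) insert.hyps(1) by (rule finite_subset)
      then have m: "Suc (card D) = m" using A(2) D by simp
      have xV: "x \<in> V" "x \<notin> D" "x \<noteq> v" using x 3 by (auto simp: D_def)
      have "e A \<in> V - A" unfolding e_def by (rule someI[of _ x]) (use x 3 in auto)
      then obtain y where y: "e A = y" "y \<in> V" "y \<notin> D" "y \<noteq> v" using D by auto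
      have nzd: "d (insert w D) \<noteq> 0" if "w \<in> V" "w \<notin> D" for w
        using nz[of "insert w D" v] a[of "insert w D"] D m finD vV that by (auto simp: d_def)
      have a'A: "a' A = F (insert v D) (insert y (insert v D)) / d (insert y D)"
        using 3 y D by (simp add: a'_def)
      have c'x: "c' (insert x A) = d (insert x D)"
        using 3 D xV by (simp add: c'_def insert_Diff_if)
      show ?thesis
      proof (cases "x = y")
        case True
        then show ?thesis using nzd[OF y(2,3)] unfolding a'A c'x by (simp add: D(1))
      next
        case False
        \<comment> \<open>This set avoids \<open>v\<close>, so the induction hypothesis applies to
          both flags below it. Their common factor \<open>c ?C\<close> cancels from the triangle
          identity for \<open>v\<close>, \<open>x\<close>, \<open>y\<close>.\<close>
        let ?C = "insert x (insert y D)"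
        have Fx: "F (insert x D) ?C = a (insert x D) * c ?C"
          using ac[of "insert x D" y] xV y False D(3) m finD by (simp add: insert_commute)
        have Fy: "F (insert y D) ?C = a (insert y D) * c ?C"
          using ac[of "insert y D" x] xV y False D(3) m finD by simp
        have "F (insert v D) (insert v (insert x D)) * F (insert x D) ?C *
            F (insert y D) (insert y (insert v D)) =
          F (insert v D) (insert y (insert v D)) * F (insert x D) (insert v (insert x D)) *
            F (insert y D) ?C"
          using xV y False D m by (intro tri) auto
        then have "F (insert v D) (insert v (insert x D)) * a (insert x D) *
            F (insert y D) (insert y (insert v D)) =
          F (insert v D) (insert y (insert v D)) * F (insert x D) (insert v (insert x D)) *
            a (insert y D)"
          using c[of ?C] by (simp add: Fx Fy mult.assoc)
        moreover have "F (insert y D) (insert v (insert y D)) \<noteq> 0"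
          using nzd[OF y(2,3)] by (auto simp: d_def)
        ultimately show ?thesis
          unfolding a'A c'x d_def unfolding D(1) using a
          by (simp add: field_simps insert_commute)
      qed
    qed
  qed
  \<comment> \<open>Zeros of \<open>a'\<close> and \<open>c'\<close> can occur only at sets in no
    relevant flag, because \<open>F\<close> is nonzero on flags; replacing them by 1 is
    harmless.\<close>
  let ?nz = "\<lambda>h X. if h X = 0 then 1 else h X"
  have "F A (insert x A) = ?nz a' A * ?nz c' (insert x A)"
    if "A \<subseteq> insert v V" "card A = m" "x \<in> insert v V - A" for A x
    using fact[OF that] nz[OF that] by auto
  then show ?case by (intro exI[of _ "?nz a'"] exI[of _ "?nz c'"]) simp
qed

section \<open>Positions in an ordered family\<close>

definition preceding :: "'b list \<Rightarrow> 'b \<Rightarrow> 'b set" where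
  "preceding G x = set (takeWhile (\<lambda>g. g \<noteq> x) G)"

text \<open>The sign of moving \<open>x\<close> from its place in \<open>insert x A\<close> to the
  front, one transposition for each element of \<open>A\<close> before it.\<close>

definition position_sign :: "'b list \<Rightarrow> 'b set \<Rightarrow> 'b \<Rightarrow> 'a::comm_ring_1" where
  "position_sign G A x = (- 1) ^ card (A \<inter> preceding G x)"

lemma position_sign_squared: "position_sign G A x * position_sign G A x = 1"
  by (simp add: position_sign_def flip: power_mult_distrib)

lemma split_at_element:
  assumes "x \<in> set G" "distinct G"
  obtains us vs where "G = us @ x # vs" "preceding G x = set us" "x \<notin> set us" "x \<notin> set vs"
    "set us \<inter> set vs = {}"
proof -
  obtain us vs where G: "G = us @ x # vs" "x \<notin> set us"
    using split_list_first[OF assms(1)] by blast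
  moreover have "takeWhile (\<lambda>g. g \<noteq> x) G = us" unfolding G(1) using G(2)
    by (subst takeWhile_append2) auto
  ultimately show thesis using assms(2) by (intro that[of us vs]) (auto simp: preceding_def)
qed

lemma preceding_total:
  assumes "distinct G" "x \<in> set G" "y \<in> set G" "x \<noteq> y"
  shows "x \<in> preceding G y \<longleftrightarrow> y \<notin> preceding G x"
proof -
  obtain us vs where G: "G = us @ x # vs" "preceding G x = set us" "x \<notin> set us" "x \<notin> set vs"
    "set us \<inter> set vs = {}"
    using split_at_element[OF assms(2,1)] .
  show ?thesis
  proof (cases "y \<in> set us")
    case True
    then have "takeWhile (\<lambda>g. g \<noteq> y) G = takeWhile (\<lambda>g. g \<noteq> y) us" unfolding G(1) by simp
    then show ?thesis using True G by (auto simp: preceding_def dest: set_takeWhileD)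
  next
    case False
    then have "takeWhile (\<lambda>g. g \<noteq> y) G = us @ x # takeWhile (\<lambda>g. g \<noteq> y) vs"
      unfolding G(1) using assms(4) by (subst takeWhile_append2) auto
    then show ?thesis using False G(2) by (simp add: preceding_def)
  qed
qed

lemma position_sign_insert:
  assumes "finite D" "y \<notin> D"
  shows "position_sign G (insert y D) x = (if y \<in> preceding G x then - 1 else 1) * position_sign G D x"
  using assms by (simp add: position_sign_def Int_insert_left)

text \<open>The contributions of \<open>D\<close> agree on both sides. For each of the three pairs
  exactly one element precedes the other, so each pair contributes one factor -1.\<close>

lemma position_sign_triple:
  fixes G :: "'b list"
  assumes "distinct G" "finite D" "{x, y, z} \<subseteq> set G - D" "x \<noteq> y" "x \<noteq> z" "y \<noteq> z"
  defines "s \<equiv> position_sign G :: 'b set \<Rightarrow> 'b \<Rightarrow> 'a::comm_ring_1"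
  shows "s (insert x D) y * s (insert y D) z * s (insert z D) x =
    - (s (insert x D) z * s (insert y D) x * s (insert z D) y)"
  using assms preceding_total[of G x y] preceding_total[of G y z] preceding_total[of G x z]
  by (simp add: position_sign_insert mult_ac)

lemma inherited_order_insert:
  assumes "distinct G" "x \<in> set G" "x \<notin> A"
  obtains us vs where "inherited_order G (insert x A) = us @ x # vs" "inherited_order G A = us @ vs"
    "(- 1) ^ length us = (position_sign G A x :: 'a::comm_ring_1)"
proof -
  obtain us vs where G: "G = us @ x # vs" "preceding G x = set us" "x \<notin> set us" "x \<notin> set vs"
    "set us \<inter> set vs = {}"
    using split_at_element[OF assms(2,1)] .
  let ?f = "filter (\<lambda>g. g \<in> A)"
  have f: "filter (\<lambda>g. g \<in> insert x A) ws = ?f ws" if "x \<notin> set ws" for ws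
    using that by (auto intro: filter_cong)
  show thesis
  proof
    show "inherited_order G (insert x A) = ?f us @ x # ?f vs"
      using f[OF G(3)] f[OF G(4)] by (simp add: inherited_order_def G(1))
    show "inherited_order G A = ?f us @ ?f vs"
      using assms(3) by (simp add: inherited_order_def G(1))
    have "distinct (?f us)" using assms(1) G(1) by simp
    then have "length (?f us) = card (A \<inter> set us)"
      by (simp flip: distinct_card add: Int_def conj_commute)
    then show "(- 1) ^ length (?f us) = position_sign G A x"
      by (simp add: position_sign_def G(2))
  qed
qed

lemma inherited_order_subset:
  assumes "distinct G" "A \<subseteq> set G"
  shows "set (inherited_order G A) = A" "distinct (inherited_order G A)"
    "length (inherited_order G A) = card A"
proof -
  show s: "set (inherited_order G A) = A" and d: "distinct (inherited_order G A)"
    using assms by (auto simp: inherited_order_def)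
  show "length (inherited_order G A) = card A" using distinct_card[OF d] s by simp
qed

text \<open>Moving \<open>x\<close> to the front passes the elements of \<open>A\<close> before it,
  which gives the position sign, and also \<open>y\<close>, which gives the additional
  minus.\<close>

lemma det_wrt_insert_order:
  fixes B :: "'a::field vec list"
  assumes "ordered_basis k B" "distinct G" "set G \<subseteq> carrier_vec k"
    and "A \<subseteq> set G" "x \<in> set G - A" "y \<in> set G" "card A + 2 = k"
  shows "det_wrt k B (x # y # inherited_order G A) =
    - position_sign G A x * det_wrt k B (y # inherited_order G (insert x A))"
proof -
  obtain us vs where uv: "inherited_order G (insert x A) = us @ x # vs" "inherited_order G A = us @ vs"
    "(- 1) ^ length us = (position_sign G A x :: 'a)"
    using inherited_order_insert[of G x A] assms by auto
  have car: "set (us @ vs) \<subseteq> carrier_vec k" and len: "length (us @ vs) + 2 = k"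
    using inherited_order_subset[OF assms(2,4)] assms by (auto simp: uv(2))
  have xy: "x \<in> carrier_vec k" "y \<in> carrier_vec k" using assms by auto
  have "det (mat_of_rows k ((y # us) @ x # vs)) =
      (- 1) ^ length (y # us) * det (mat_of_rows k (x # (y # us) @ vs))"
    by (rule det_move_to_front) (use car len xy in auto)
  then have "det (mat_of_rows k (y # us @ x # vs)) =
      - position_sign G A x * det (mat_of_rows k (x # y # us @ vs))"
    by (simp add: uv(3))
  then have "- position_sign G A x * det (mat_of_rows k (y # us @ x # vs)) =
      position_sign G A x * position_sign G A x * det (mat_of_rows k (x # y # us @ vs))"
    by simp
  then have "det (mat_of_rows k (x # y # us @ vs)) =
      - position_sign G A x * det (mat_of_rows k (y # us @ x # vs))"
    by (simp add: position_sign_squared)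
  moreover have "det_wrt k B (x # y # us @ vs) = det (mat_of_rows k (x # y # us @ vs)) / det (mat_of_cols k B)"
    "det_wrt k B (y # us @ x # vs) = det (mat_of_rows k (y # us @ x # vs)) / det (mat_of_cols k B)"
    by (rule det_wrt_eq[OF assms(1)]; use car len xy in simp)+
  ultimately show ?thesis by (simp add: uv(1,2))
qed

lemma det_wrt_nonzero:
  assumes "ordered_basis k B" "ordered_basis k xs"
  shows "det_wrt k B xs \<noteq> 0"
  using ordered_basisD[OF assms(1)] ordered_basisD[OF assms(2)]
  by (simp add: det_wrt_eq[OF assms(1)] det_mat_of_rows_eq_cols)

section \<open>The diagonal equivalence\<close>

lemma diagonal_mat_mat_diag: "diagonal_mat (mat_diag n f)"
  by (simp add: diagonal_mat_def mat_diag_def)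

lemma invertible_mat_diag:
  fixes f :: "nat \<Rightarrow> 'a::field"
  assumes "\<And>i. i < n \<Longrightarrow> f i \<noteq> 0"
  shows "invertible_mat (mat_diag n f)"
proof -
  have "mat_diag n (\<lambda>i. f i * inverse (f i)) = 1\<^sub>m n" "mat_diag n (\<lambda>i. inverse (f i) * f i) = 1\<^sub>m n"
    using assms by (auto simp: mat_diag_def)
  moreover have "dim_row (mat_diag n g) = n" "dim_col (mat_diag n g) = n" for g :: "nat \<Rightarrow> 'a"
    by (simp_all add: mat_diag_def)
  ultimately show ?thesis unfolding invertible_mat_def inverts_mat_def
    by (auto intro!: exI[of _ "mat_diag n (\<lambda>i. inverse (f i))"])
qed

lemma mat_diag_mult_indexed_mat:
  fixes f :: "'r \<Rightarrow> 'c \<Rightarrow> 'a::field"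
  assumes "\<And>r c. r \<in> set rs \<Longrightarrow> c \<in> set cs \<Longrightarrow> d\<^sub>1 r * f r c * d\<^sub>2 c = g r c"
  shows "mat_diag (length rs) (\<lambda>i. d\<^sub>1 (rs ! i)) * indexed_mat rs cs f *
    mat_diag (length cs) (\<lambda>j. d\<^sub>2 (cs ! j)) = indexed_mat rs cs g"
proof -
  have "mat_diag (length rs) (\<lambda>i. d\<^sub>1 (rs ! i)) * indexed_mat rs cs f =
      mat (length rs) (length cs) (\<lambda>(i, j). d\<^sub>1 (rs ! i) * f (rs ! i) (cs ! j))"
    by (subst mat_diag_mult_left[of _ _ "length cs"]) (auto simp: indexed_mat_def)
  then show ?thesis
    by (simp add: mat_diag_mult_right[of _ "length rs"]) (auto simp: indexed_mat_def assms)
qed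

theorem theorem4p2:
  fixes k n :: nat
    and t :: int
    and S G B :: "'a::{field,finite} vec list"
    and \<beta> :: "'a vec set \<Rightarrow> 'a vec set \<Rightarrow> 'a vec \<Rightarrow> 'a"
    and b\<^sub>1 b\<^sub>2 :: "'a vec set \<Rightarrow> 'a vec"
    and Bs :: "'a vec set \<Rightarrow> 'a vec list"
    and rs :: "'a vec set list"
    and cs :: "('a vec set \<times> 'a vec set) list"
  assumes "2 \<le> k"
    and "arc k S"
    and "t = int CARD('a) + int k - 1 - int (length S)"
    and "subseq G S"
    and "int (length G) = t + int k + int n"
    and "tangent_choice k S \<beta>"
    and "\<And>A. A \<in> nsets (set G) (k - 2) \<Longrightarrow>
           Bs A = b\<^sub>1 A # b\<^sub>2 A # inherited_order G A \<and> ordered_basis k (Bs A)"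
    and "ordered_basis k B"
    and "distinct rs" and "set rs = nsets (set G) (k - 1)"
    and "distinct cs" and "set cs = column_index k n G"
  shows "\<exists>D\<^sub>1 D\<^sub>2.
           D\<^sub>1 \<in> carrier_mat (length rs) (length rs) \<and> diagonal_mat D\<^sub>1 \<and> invertible_mat D\<^sub>1 \<and>
           D\<^sub>2 \<in> carrier_mat (length cs) (length cs) \<and> diagonal_mat D\<^sub>2 \<and> invertible_mat D\<^sub>2 \<and>
           D\<^sub>1 * indexed_mat rs cs (P_entry k S \<beta> Bs G) * D\<^sub>2 = indexed_mat rs cs (M_entry k B G)"
proof -
  \<comment> \<open>This is \<open>t + 1\<close>: both the exponent of the sign in the lemma of
    tangents and the number of determinants in a nonzero entry of P.\<close>
  define N where "N = CARD('a) + k - length S"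
  define f where "f = tangent_function k S \<beta>"
  define s where "s = (position_sign G :: 'a vec set \<Rightarrow> 'a vec \<Rightarrow> 'a)"
  \<comment> \<open>Each of the \<open>N\<close> determinants in an entry contributes one position
    sign, whence the power.\<close>
  define F where "F A C = f A (the_elem (C - A)) * s A (the_elem (C - A)) ^ N" for A C
  define q where "q C y = det_wrt k B (y # inherited_order G C)" for C y
  define \<mu> where "\<mu> A = det (mat_of_cols k B) / det (mat_of_cols k (Bs A))" for A
  note k = assms(1) and arc = assms(2) and tc = assms(6) and B = assms(8)
  have dS: "distinct S" by (rule arc_distinct[OF k arc])
  obtain I where "G = nths S I" using assms(4) by (auto simp: subseq_conv_nths)
  then have dG: "distinct G" and GS: "set G \<subseteq> set S"
    using dS by (simp_all add: distinct_nthsI set_nths_subset)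
  have carS: "set S \<subseteq> carrier_vec k" using arc by (simp add: arc_def)
  then have carG: "set G \<subseteq> carrier_vec k" using GS by blast
  have F_insert: "F A (insert x A) = f A x * s A x ^ N" if "x \<notin> A" for A x
  proof -
    have "insert x A - A = {x}" using that by auto
    then show ?thesis by (simp add: F_def)
  qed
  have s_nz: "s A x \<noteq> 0" for A x
    using position_sign_squared[of G A x, where 'a='a] by (auto simp: s_def)
  have "\<exists>a c. (\<forall>A. a A \<noteq> 0) \<and> (\<forall>C. c C \<noteq> 0) \<and>
    (\<forall>A x. A \<subseteq> set G \<longrightarrow> card A = k - 2 \<longrightarrow> x \<in> set G - A \<longrightarrow> F A (insert x A) = a A * c (insert x A))"
  proof (rule flag_function_factorization)
    fix A x assume A: "A \<subseteq> set G" "card A = k - 2" "x \<in> set G - A"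
    have "A \<in> nsets (set S) (k - 2)" using A GS finite_subset by (auto simp: nsets_def)
    then have "f A x \<noteq> 0"
      unfolding f_def using A GS by (intro tangent_function_nonzero[OF tc carS]) auto
    then show "F A (insert x A) \<noteq> 0" using A s_nz by (simp add: F_insert)
  next
    fix D x y z
    assume D: "D \<subseteq> set G" "Suc (card D) = k - 2" and xyz: "{x, y, z} \<subseteq> set G - D" "x \<noteq> y" "x \<noteq> z" "y \<noteq> z"
    have finD: "finite D" using D(1) by (rule finite_subset) simp
    have k3: "3 \<le> k" using D(2) by simp
    have D': "D \<in> nsets (set S) (k - 3)" using D GS finD by (auto simp: nsets_def)
    have tangents: "f (insert x D) y * f (insert y D) z * f (insert z D) x =
        (- 1) ^ N * (f (insert x D) z * f (insert y D) x * f (insert z D) y)"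
      unfolding f_def N_def using xyz GS by (intro lemma_of_tangents[OF k3 arc tc D']) auto
    have signs: "s (insert x D) y * s (insert y D) z * s (insert z D) x =
        - 1 * (s (insert x D) z * s (insert y D) x * s (insert z D) y)"
      unfolding s_def using position_sign_triple[OF dG finD xyz] by simp
    \<comment> \<open>One sign comes from the lemma of tangents and one from the positions; their
      cancellation is the triangle identity for \<open>F\<close>.\<close>
    have one: "(- 1) ^ N * (- 1) ^ N = (1 :: 'a)" by (simp flip: power_mult_distrib)
    have "F (insert x D) (insert y (insert x D)) * F (insert y D) (insert z (insert y D)) *
        F (insert z D) (insert x (insert z D)) =
      (f (insert x D) y * f (insert y D) z * f (insert z D) x) *
      (s (insert x D) y * s (insert y D) z * s (insert z D) x) ^ N"
      using xyz by (simp add: F_insert power_mult_distrib mult_ac)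
    also have "\<dots> = ((- 1) ^ N * (- 1) ^ N) * ((f (insert x D) z * f (insert y D) x * f (insert z D) y) *
      (s (insert x D) z * s (insert y D) x * s (insert z D) y) ^ N)"
      unfolding tangents signs power_mult_distrib[of "- 1"] by (simp only: mult_ac)
    also have "\<dots> = F (insert x D) (insert z (insert x D)) * F (insert y D) (insert x (insert y D)) *
        F (insert z D) (insert y (insert z D))"
      using xyz unfolding one by (simp add: F_insert power_mult_distrib mult_ac)
    finally show "F (insert x D) (insert x (insert y D)) * F (insert y D) (insert y (insert z D)) *
        F (insert z D) (insert z (insert x D)) =
      F (insert x D) (insert z (insert x D)) * F (insert y D) (insert x (insert y D)) *
        F (insert z D) (insert y (insert z D))"
      by (simp only: insert_commute)
  qed simp
  then obtain a c where a: "\<And>A. a A \<noteq> 0" and c: "\<And>C. c C \<noteq> 0"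
    and ac: "\<And>A x. A \<subseteq> set G \<Longrightarrow> card A = k - 2 \<Longrightarrow> x \<in> set G - A \<Longrightarrow> f A x * s A x ^ N = a A * c (insert x A)"
    using F_insert by (metis DiffD2)
  \<comment> \<open>The product over \<open>set G - C\<close> cancels the inverse product over
    \<open>W\<close> and leaves the one over \<open>U\<close>. The remaining factors,
    \<open>c C\<close> and those depending on \<open>A\<close> alone, are divided out by
    \<open>d\<^sub>1\<close> and \<open>d\<^sub>2\<close>.\<close>
  define d\<^sub>1 where "d\<^sub>1 C = prod (q C) (set G - C) / c C" for C
  define d\<^sub>2 where "d\<^sub>2 = (\<lambda>(U :: 'a vec set, A). (- \<mu> A) ^ N / a A)"
  have q_nz: "q C y \<noteq> 0" if C: "C \<in> nsets (set G) (k - 1)" and y: "y \<in> set G - C" for C y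
  proof -
    have C': "C \<subseteq> set G" "finite C" "card C = k - 1" using C by (auto simp: nsets_def)
    note io = inherited_order_subset[OF dG C'(1)]
    have "ordered_basis k (y # inherited_order G C)"
      by (rule arc_ordered_basis[OF k arc, of "insert y C"]) (use C' y k GS io in auto)
    then show ?thesis unfolding q_def by (rule det_wrt_nonzero[OF B])
  qed
  have \<mu>_nz: "\<mu> A \<noteq> 0" if "A \<in> nsets (set G) (k - 2)" for A
    using ordered_basisD(3)[OF B] ordered_basisD(3)[of k "Bs A"] assms(7)[OF that] by (auto simp: \<mu>_def)
  have entry: "d\<^sub>1 C * P_entry k S \<beta> Bs G C p * d\<^sub>2 p = M_entry k B G C p"
    if C: "C \<in> set rs" and p: "p \<in> set cs" for C p
  proof -
    obtain U A where UA: "p = (U, A)" by force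
    have C: "C \<in> nsets (set G) (k - 1)" using C assms(10) by simp
    have U: "U \<subseteq> set G" "finite U" "card U = n" and A: "A \<subseteq> set G - U" "finite A" "card A = k - 2"
      using p assms(12) by (auto simp: column_index_def nsets_def UA)
    have AG: "A \<subseteq> set G" using A(1) by blast
    then have A': "A \<in> nsets (set G) (k - 2)" using A by (auto simp: nsets_def)
    show ?thesis
    proof (cases "A \<subseteq> C \<and> C \<subseteq> set G - U")
      case True
      have C': "finite C" "card C = k - 1" using C by (auto simp: nsets_def)
      have "card (C - A) = 1" using True A C' k by (simp add: card_Diff_subset)
      then obtain x where x: "C - A = {x}" by (auto simp: card_1_singleton_iff)
      have Cx: "C = insert x A" "x \<notin> A" "x \<in> set G" using x True by auto
      define W where "W = set G - (C \<union> U)"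
      have "card (C \<union> U) = k - 1 + n" using True C' U by (subst card_Un_disjoint) auto
      then have "card W = length G - (k - 1 + n)"
        unfolding W_def using True U C' distinct_card[OF dG] by (subst card_Diff_subset) auto
      \<comment> \<open>The size \<open>t + k + n\<close> of \<open>G\<close> leaves
        \<open>t + 1\<close> vectors outside \<open>C\<close> and \<open>U\<close>.\<close>
      then have W: "card W = N" using assms(3,5) k by (simp add: N_def)
      have Bs: "ordered_basis k (Bs A)" using assms(7)[OF A'] by blast
      \<comment> \<open>Passing from \<open>Bs A\<close> to \<open>B\<close> costs
        \<open>\<mu> A\<close>; reordering the rows costs a sign that does not depend on
        \<open>y\<close>.\<close>
      have det: "det_wrt k (Bs A) (x # y # inherited_order G A) = (- \<mu> A * s A x) * q C y" if y: "y \<in> W" for y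
      proof -
        have io: "set (x # y # inherited_order G A) \<subseteq> carrier_vec k"
          "length (x # y # inherited_order G A) = k"
          using inherited_order_subset[OF dG AG] A y Cx(3) k carG by (auto simp: W_def)
        have "det_wrt k (Bs A) (x # y # inherited_order G A) = \<mu> A * det_wrt k B (x # y # inherited_order G A)"
          unfolding det_wrt_eq[OF B io] det_wrt_eq[OF Bs io]
          using ordered_basisD(3)[OF B] by (simp add: \<mu>_def)
        also have "det_wrt k B (x # y # inherited_order G A) = - s A x * q C y"
          unfolding s_def q_def Cx(1) using A Cx k y
          by (intro det_wrt_insert_order[OF B dG carG]) (auto simp: W_def)
        finally show ?thesis by simp
      qed
      have s2: "inverse (s A x) = s A x"
        using position_sign_squared[of G A x, where 'a='a] unfolding s_def by (rule inverse_unique)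
      have "P_entry k S \<beta> Bs G C p =
          f A x * (\<Prod>y\<in>W. inverse (det_wrt k (Bs A) (x # y # inherited_order G A)))"
        using True by (simp add: P_entry_def UA x f_def W_def)
      also have "(\<Prod>y\<in>W. inverse (det_wrt k (Bs A) (x # y # inherited_order G A))) =
          (\<Prod>y\<in>W. (inverse (- \<mu> A) * s A x) * inverse (q C y))"
        using det by (intro prod.cong) (auto simp: s2)
      also have "\<dots> = (inverse (- \<mu> A) * s A x) ^ N * inverse (prod (q C) W)"
        by (simp only: prod.distrib prod_constant W power_mult_distrib flip: prod_inversef[unfolded o_def])
      finally have "P_entry k S \<beta> Bs G C p = (f A x * s A x ^ N) * inverse (- \<mu> A) ^ N * inverse (prod (q C) W)"
        by (simp only: power_mult_distrib mult_ac)
      also have "f A x * s A x ^ N = a A * c C"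
        unfolding Cx(1) using A Cx by (intro ac) auto
      finally have P: "P_entry k S \<beta> Bs G C p = a A * c C * inverse (- \<mu> A) ^ N * inverse (prod (q C) W)" .
      have "set G - C = W \<union> U" "W \<inter> U = {}" using True U by (auto simp: W_def)
      then have split: "prod (q C) (set G - C) = prod (q C) W * prod (q C) U"
        using U by (simp add: prod.union_disjoint W_def)
      have W_nz: "prod (q C) W \<noteq> 0" using q_nz[OF C] by (auto simp: W_def)
      have \<mu>N: "inverse (- \<mu> A) ^ N * (- \<mu> A) ^ N = 1"
        using \<mu>_nz[OF A'] by (simp flip: power_mult_distrib)
      have "d\<^sub>1 C * P_entry k S \<beta> Bs G C p * d\<^sub>2 p =
          (inverse (- \<mu> A) ^ N * (- \<mu> A) ^ N) * (a A * inverse (a A)) * (c C * inverse (c C)) *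
          (prod (q C) W * inverse (prod (q C) W)) * prod (q C) U"
        unfolding P unfolding d\<^sub>1_def d\<^sub>2_def split UA by (simp only: divide_inverse prod.case mult_ac)
      also have "\<dots> = prod (q C) U" unfolding \<mu>N using W_nz a c by simp
      also have "\<dots> = M_entry k B G C p" using True by (simp add: M_entry_def UA q_def)
      finally show ?thesis .
    qed (auto simp: P_entry_def M_entry_def UA)
  qed
  have d\<^sub>1_nz: "d\<^sub>1 C \<noteq> 0" if "C \<in> set rs" for C
    using that assms(10) q_nz c by (simp add: d\<^sub>1_def)
  have d\<^sub>2_nz: "d\<^sub>2 p \<noteq> 0" if "p \<in> set cs" for p
  proof -
    obtain U A where UA: "p = (U, A)" by force
    then have "A \<in> nsets (set G) (k - 2)"
      using that assms(12) by (auto simp: column_index_def nsets_def)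
    then show ?thesis using \<mu>_nz a by (simp add: d\<^sub>2_def UA)
  qed
  show ?thesis
    by (intro exI[of _ "mat_diag (length rs) (\<lambda>i. d\<^sub>1 (rs ! i))"]
        exI[of _ "mat_diag (length cs) (\<lambda>j. d\<^sub>2 (cs ! j))"] conjI)
      (use d\<^sub>1_nz d\<^sub>2_nz entry in \<open>simp_all add: diagonal_mat_mat_diag invertible_mat_diag mat_diag_mult_indexed_mat\<close>)
qed

end
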